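(* Let $n \geq 2$ be a natural number, let $L_{n+1} = \left\{0,\frac{1}{n},\ldots,\frac{n-1}{n},1\right\}$, let $r \geq 1$ and let $f : L_{n+1}^r \to L_{n+1}$ be a function. The following are equivalent: (a) $f$ is Moisil representable; (b) for any $a_1,\ldots,a_r \in L_{n+1}$ we have that $f(a_1,\ldots,a_r) \in \{0,1,a_1,\ldots,a_r,1-a_1,\ldots,1-a_r\}$.
   Context: Fix a natural number $n \geq 2$. The signature of $LM_n$-algebras (that is, $n$-nuanced, or $(n+1)$-valued, Łukasiewicz-Moisil algebras) consists of two binary operation symbols $\vee,\wedge$, a unary operation symbol $N$, two constants $0,1$, and $n$ unary operation symbols $\Delta_1,\ldots,\Delta_n$. The standard $LM_n$-algebra $\mathcal{L}_n$ is the algebra over this signature with underlying set $L_{n+1}=\left\{0,\frac{1}{n},\ldots,\frac{n-1}{n},1\right\}$, in which $x \vee y = \max(x,y)$, $x \wedge y = \min(x,y)$, $Nx = 1-x$, the constants $0$ and $1$ are interpreted as the numbers $0$ and $1$, and for all $i \in \{1,\ldots,n\}$ and $j \in \{0,\ldots,n\}$, $$\Delta_i\left(\frac{j}{n}\right) = \begin{cases} 1, & \text{if } i+j \geq n+1,\\ 0, & \text{otherwise.}\end{cases}$$ For a set $X$, $T_n(X)$ denotes the term algebra with variables from $X$ over the signature of $LM_n$-algebras (the absolutely free algebra of that signature over $X$; no identities are imposed). A morphism $\varphi : T_n(X) \to \mathcal{L}_n$ is a homomorphism of algebras over this signature. For $r \geq 1$ and $f : L_{n+1}^r \to L_{n+1}$,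 a term $t \in T_n(\{x_1,\ldots,x_r\})$ (with $x_1,\ldots,x_r$ distinct variables) is a representing term for $f$ if for each morphism $\varphi : T_n(\{x_1,\ldots,x_r\}) \to \mathcal{L}_n$ we have $f(\varphi(x_1),\ldots,\varphi(x_r)) = \varphi(t)$. The function $f$ is Moisil representable if it has a representing term. *)

theory Defs
  imports Complex_Main "HOL-Library.FuncSet"
begin

text \<open>
  Algebras over the signature of n-nuanced Lukasiewicz-Moisil algebras. The record does not
  depend on n: only the operations \<open>lm_Delta A i\<close> with \<open>i \<in> {1..n}\<close> belong to the signature,
  and its values at other indices are ignored below. No identities are assumed.
\<close>

record 'a lm_algebra =
  lm_carrier :: "'a set"
  lm_join :: "'a \<Rightarrow> 'a \<Rightarrow> 'a"
  lm_meet :: "'a \<Rightarrow> 'a \<Rightarrow> 'a"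
  lm_N :: "'a \<Rightarrow> 'a"
  lm_zero :: 'a
  lm_one :: 'a
  lm_Delta :: "nat \<Rightarrow> 'a \<Rightarrow> 'a"

definition lm_closed :: "nat \<Rightarrow> 'a lm_algebra \<Rightarrow> bool" where
  "lm_closed n A \<longleftrightarrow>
     (\<forall>x \<in> lm_carrier A. \<forall>y \<in> lm_carrier A.
        lm_join A x y \<in> lm_carrier A \<and> lm_meet A x y \<in> lm_carrier A) \<and>
     (\<forall>x \<in> lm_carrier A. lm_N A x \<in> lm_carrier A) \<and>
     lm_zero A \<in> lm_carrier A \<and> lm_one A \<in> lm_carrier A \<and>
     (\<forall>i \<in> {1..n}. \<forall>x \<in> lm_carrier A. lm_Delta A i x \<in> lm_carrier A)"

definition lm_hom :: "nat \<Rightarrow> 'a lm_algebra \<Rightarrow> 'b lm_algebra \<Rightarrow> ('a \<Rightarrow> 'b) set" where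
  "lm_hom n A B = {\<phi>. \<phi> \<in> lm_carrier A \<rightarrow> lm_carrier B \<and>
     (\<forall>x \<in> lm_carrier A. \<forall>y \<in> lm_carrier A.
        \<phi> (lm_join A x y) = lm_join B (\<phi> x) (\<phi> y) \<and>
        \<phi> (lm_meet A x y) = lm_meet B (\<phi> x) (\<phi> y)) \<and>
     (\<forall>x \<in> lm_carrier A. \<phi> (lm_N A x) = lm_N B (\<phi> x)) \<and>
     \<phi> (lm_zero A) = lm_zero B \<and> \<phi> (lm_one A) = lm_one B \<and>
     (\<forall>i \<in> {1..n}. \<forall>x \<in> lm_carrier A. \<phi> (lm_Delta A i x) = lm_Delta B i (\<phi> x))}"

definition luk_set :: "nat \<Rightarrow> real set" where
  "luk_set n = (\<lambda>j. real j / real n) ` {0..n}"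

text \<open>
  The condition \<open>i + j \<ge> n + 1\<close> is stated through a numerator \<open>j\<close> of \<open>x\<close>, which for
  \<open>x \<in> luk_set n\<close> exists and is unique; see \<open>luk_Delta_frac\<close>.
\<close>

definition luk_Delta :: "nat \<Rightarrow> nat \<Rightarrow> real \<Rightarrow> real" where
  "luk_Delta n i x =
     (if \<exists>j \<in> {0..n}. x = real j / real n \<and> i + j \<ge> n + 1 then 1 else 0)"

lemma luk_Delta_frac:
  assumes "n > 0" "j \<le> n"
  shows "luk_Delta n i (real j / real n) = (if i + j \<ge> n + 1 then 1 else 0)"
  using assms by (auto simp: luk_Delta_def divide_simps)

definition luk_algebra :: "nat \<Rightarrow> real lm_algebra" where
  "luk_algebra n = \<lparr>
     lm_carrier = luk_set n,
     lm_join = max,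
     lm_meet = min,
     lm_N = (\<lambda>x. 1 - x),
     lm_zero = 0,
     lm_one = 1,
     lm_Delta = luk_Delta n \<rparr>"

lemma luk_algebra_closed:
  assumes "n > 0"
  shows "lm_closed n (luk_algebra n)"
proof -
  have 0: "0 \<in> luk_set n" unfolding luk_set_def by (rule image_eqI[of _ _ 0]) auto
  have 1: "1 \<in> luk_set n" unfolding luk_set_def using assms by (intro image_eqI[of _ _ n]) auto
  have "1 - x \<in> luk_set n" if "x \<in> luk_set n" for x
  proof -
    from that obtain j where "j \<le> n" "x = real j / real n" by (auto simp: luk_set_def)
    with assms have "1 - x = real (n - j) / real n" by (simp add: of_nat_diff field_simps)
    then show ?thesis unfolding luk_set_def by auto
  qed
  with 0 1 show ?thesis
    by (auto simp: lm_closed_def luk_algebra_def luk_Delta_def max_def min_def)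
qed

datatype 'v lm_term =
    Var 'v
  | Join "'v lm_term" "'v lm_term"
  | Meet "'v lm_term" "'v lm_term"
  | Neg "'v lm_term"
  | Zero
  | One
  | Delta nat "'v lm_term"

text \<open>The datatype allows arbitrary variables and indices of \<open>Delta\<close>; the following set
  carves out the terms over the signature for n with variables from \<open>X\<close>.\<close>

inductive_set lm_terms :: "nat \<Rightarrow> 'v set \<Rightarrow> 'v lm_term set" for n :: nat and X :: "'v set" where
  "x \<in> X \<Longrightarrow> Var x \<in> lm_terms n X"
| "\<lbrakk>s \<in> lm_terms n X; t \<in> lm_terms n X\<rbrakk> \<Longrightarrow> Join s t \<in> lm_terms n X"
| "\<lbrakk>s \<in> lm_terms n X; t \<in> lm_terms n X\<rbrakk> \<Longrightarrow> Meet s t \<in> lm_terms n X"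
| "t \<in> lm_terms n X \<Longrightarrow> Neg t \<in> lm_terms n X"
| "Zero \<in> lm_terms n X"
| "One \<in> lm_terms n X"
| "\<lbrakk>i \<in> {1..n}; t \<in> lm_terms n X\<rbrakk> \<Longrightarrow> Delta i t \<in> lm_terms n X"

definition lm_term_algebra :: "nat \<Rightarrow> 'v set \<Rightarrow> 'v lm_term lm_algebra" where
  "lm_term_algebra n X = \<lparr>
     lm_carrier = lm_terms n X,
     lm_join = Join,
     lm_meet = Meet,
     lm_N = Neg,
     lm_zero = Zero,
     lm_one = One,
     lm_Delta = Delta \<rparr>"

lemma lm_term_algebra_closed: "lm_closed n (lm_term_algebra n X)"
  by (auto simp: lm_closed_def lm_term_algebra_def intro: lm_terms.intros)

text \<open>
  Elements of \<open>L\<^sub>n\<^sub>+\<^sub>1\<^sup>r\<close> are extensional functions on the index set \<open>{1..r}\<close>, and the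
  variables \<open>x\<^sub>1, \<dots>, x\<^sub>r\<close> are \<open>Var 1, \<dots>, Var r\<close>.
\<close>

definition luk_tuples :: "nat \<Rightarrow> nat \<Rightarrow> (nat \<Rightarrow> real) set" where
  "luk_tuples n r = ({1..r} \<rightarrow>\<^sub>E luk_set n)"

definition representing_term ::
  "nat \<Rightarrow> nat \<Rightarrow> ((nat \<Rightarrow> real) \<Rightarrow> real) \<Rightarrow> nat lm_term \<Rightarrow> bool" where
  "representing_term n r f t \<longleftrightarrow>
     t \<in> lm_carrier (lm_term_algebra n {1..r}) \<and>
     (\<forall>\<phi> \<in> lm_hom n (lm_term_algebra n {1..r}) (luk_algebra n).
        f (\<lambda>i\<in>{1..r}. \<phi> (Var i)) = \<phi> t)"

definition moisil_representable ::
  "nat \<Rightarrow> nat \<Rightarrow> ((nat \<Rightarrow> real) \<Rightarrow> real) \<Rightarrow> bool" where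
  "moisil_representable n r f \<longleftrightarrow> (\<exists>t. representing_term n r f t)"

end

theory Submission
  imports Defs
begin

text \<open>
  A morphism from the term algebra is evaluation at the values of the variables, so a function is
  representable exactly when it is a term function of \<open>luk_algebra n\<close> (lemma
  \<open>moisil_representable_iff_term_function\<close>).

  A term function takes only the values in (b) because, for fixed \<open>a\<close>, the set
  \<open>{0, 1, a\<^sub>1, \<dots>, a\<^sub>r, 1 - a\<^sub>1, \<dots>, 1 - a\<^sub>r}\<close> contains the values of the variables and is a
  subalgebra: \<open>max\<close> and \<open>min\<close> select one of their arguments, \<open>x \<mapsto> 1 - x\<close> permutes the set, and
  the \<open>\<Delta>\<^sub>i\<close> only produce \<open>0\<close> and \<open>1\<close>.

  Conversely, \<open>\<Delta>\<^sub>i\<close> tests whether its argument is at least \<open>(n + 1 - i)/n\<close>. Two such tests, one of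
  them negated, single out one value of one variable, and a meet of these over all the variables
  is the indicator of one tuple (lemma \<open>tuple_indicator\<close>). Condition (b) supplies for every tuple
  \<open>a\<close> one of the terms \<open>0\<close>, \<open>1\<close>, \<open>x\<^sub>i\<close>, \<open>N x\<^sub>i\<close> that has the value \<open>f a\<close> at \<open>a\<close>. Since there are only
  finitely many tuples, these terms can be glued along the indicators: the join over all tuples
  \<open>a\<close> of the meet of the indicator of \<open>a\<close> with the term chosen for \<open>a\<close> represents \<open>f\<close>
  (lemma \<open>glue_local_terms\<close>).
\<close>

primrec lm_eval :: "'a lm_algebra \<Rightarrow> ('v \<Rightarrow> 'a) \<Rightarrow> 'v lm_term \<Rightarrow> 'a" where
  "lm_eval A a (Var x) = a x"
| "lm_eval A a (Join s t) = lm_join A (lm_eval A a s) (lm_eval A a t)"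
| "lm_eval A a (Meet s t) = lm_meet A (lm_eval A a s) (lm_eval A a t)"
| "lm_eval A a (Neg t) = lm_N A (lm_eval A a t)"
| "lm_eval A a Zero = lm_zero A"
| "lm_eval A a One = lm_one A"
| "lm_eval A a (Delta i t) = lm_Delta A i (lm_eval A a t)"

lemma lm_eval_in_carrier:
  assumes "lm_closed n A" "a \<in> X \<rightarrow> lm_carrier A" "t \<in> lm_terms n X"
  shows "lm_eval A a t \<in> lm_carrier A"
  using assms(3) by induction (use assms(1,2) in \<open>auto simp: lm_closed_def\<close>)

lemma lm_eval_hom:
  assumes "lm_closed n A" "a \<in> X \<rightarrow> lm_carrier A"
  shows "lm_eval A a \<in> lm_hom n (lm_term_algebra n X) A"
  using lm_eval_in_carrier[OF assms] by (auto simp: lm_hom_def lm_term_algebra_def)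

text \<open>
  The values on the variables determine a morphism. They are restricted to \<open>X\<close> here because an
  element of \<open>luk_tuples n r\<close> is \<open>undefined\<close> off its index set.
\<close>

lemma hom_eq_lm_eval:
  assumes "\<phi> \<in> lm_hom n (lm_term_algebra n X) A" "t \<in> lm_terms n X"
  shows "\<phi> t = lm_eval A (\<lambda>x\<in>X. \<phi> (Var x)) t"
  using assms(2) by induction (use assms(1) in \<open>auto simp: lm_hom_def lm_term_algebra_def\<close>)

lemma moisil_representable_iff_term_function:
  assumes "n > 0"
  shows "moisil_representable n r f \<longleftrightarrow>
    (\<exists>t \<in> lm_terms n {1..r}. \<forall>a \<in> luk_tuples n r. lm_eval (luk_algebra n) a t = f a)"
proof -
  let ?T = "lm_term_algebra n {1..r}"
  have "representing_term n r f t \<longleftrightarrow>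
      (\<forall>a \<in> luk_tuples n r. lm_eval (luk_algebra n) a t = f a)"
    if t: "t \<in> lm_terms n {1..r}" for t
  proof
    assume rep: "representing_term n r f t"
    show "\<forall>a \<in> luk_tuples n r. lm_eval (luk_algebra n) a t = f a"
    proof
      fix a assume a: "a \<in> luk_tuples n r"
      then have "lm_eval (luk_algebra n) a \<in> lm_hom n ?T (luk_algebra n)"
        by (intro lm_eval_hom luk_algebra_closed assms)
          (auto simp: luk_tuples_def luk_algebra_def)
      with rep have "f (\<lambda>i\<in>{1..r}. a i) = lm_eval (luk_algebra n) a t"
        by (auto simp: representing_term_def)
      moreover have "(\<lambda>i\<in>{1..r}. a i) = a"
        using a by (auto simp: luk_tuples_def PiE_def intro: extensional_restrict)
      ultimately show "lm_eval (luk_algebra n) a t = f a" by simp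
    qed
  next
    assume ev: "\<forall>a \<in> luk_tuples n r. lm_eval (luk_algebra n) a t = f a"
    have "f (\<lambda>i\<in>{1..r}. \<phi> (Var i)) = \<phi> t" if \<phi>: "\<phi> \<in> lm_hom n ?T (luk_algebra n)" for \<phi>
    proof -
      have "(\<lambda>i\<in>{1..r}. \<phi> (Var i)) \<in> luk_tuples n r"
        using \<phi> unfolding luk_tuples_def
        by (auto simp: lm_hom_def lm_term_algebra_def luk_algebra_def intro: lm_terms.intros)
      with ev hom_eq_lm_eval[OF \<phi> t] show ?thesis by simp
    qed
    with t show "representing_term n r f t"
      by (auto simp: representing_term_def lm_term_algebra_def)
  qed
  then show ?thesis
    by (auto simp: moisil_representable_def representing_term_def lm_term_algebra_def)
qed

lemma term_function_values:
  assumes "t \<in> lm_terms n X"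
  shows "lm_eval (luk_algebra n) a t \<in> {0, 1} \<union> a ` X \<union> (\<lambda>x. 1 - a x) ` X"
  using assms by induction (auto simp: luk_algebra_def luk_Delta_def max_def min_def)

text \<open>
  The test whether the value of a term is at least \<open>k/n\<close>. The indices of the \<open>\<Delta>\<^sub>i\<close> cover only the
  thresholds \<open>1 \<le> k \<le> n\<close>; the trivial ones are added so that a single value can be cut out
  between \<open>k\<close> and \<open>k + 1\<close> at both ends of the chain as well.
\<close>

definition at_least_term :: "nat \<Rightarrow> nat \<Rightarrow> 'v lm_term \<Rightarrow> 'v lm_term" where
  "at_least_term n k t =
     (if k = 0 then One else if k > n then Zero else Delta (n + 1 - k) t)"

lemma at_least_term_in_lm_terms:
  "t \<in> lm_terms n X \<Longrightarrow> at_least_term n k t \<in> lm_terms n X"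
  by (auto simp: at_least_term_def intro!: lm_terms.intros)

lemma lm_eval_at_least_term:
  assumes "n > 0" "j \<le> n" "lm_eval (luk_algebra n) a t = real j / real n"
  shows "lm_eval (luk_algebra n) a (at_least_term n k t) = (if k \<le> j then 1 else 0)"
  using assms luk_Delta_frac[OF assms(1,2)] by (auto simp: at_least_term_def luk_algebra_def)

lemma value_indicator:
  assumes "n > 0" "c \<in> luk_set n" "t \<in> lm_terms n X"
  shows "\<exists>s \<in> lm_terms n X. \<forall>a \<in> X \<rightarrow> luk_set n.
    lm_eval (luk_algebra n) a s = (if lm_eval (luk_algebra n) a t = c then 1 else 0)"
proof -
  from assms(2) obtain k where k: "k \<le> n" "c = real k / real n"
    by (auto simp: luk_set_def)
  let ?s = "Meet (at_least_term n k t) (Neg (at_least_term n (k + 1) t))"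
  have "lm_eval (luk_algebra n) a ?s = (if lm_eval (luk_algebra n) a t = c then 1 else 0)"
    if a: "a \<in> X \<rightarrow> luk_set n" for a
  proof -
    have "lm_eval (luk_algebra n) a t \<in> luk_set n"
      using lm_eval_in_carrier[OF luk_algebra_closed[OF assms(1)] _ assms(3)] a
      by (simp add: luk_algebra_def)
    then obtain j where j: "j \<le> n" "lm_eval (luk_algebra n) a t = real j / real n"
      by (auto simp: luk_set_def)
    have "real j / real n = real k / real n \<longleftrightarrow> j = k"
      using assms(1) by simp
    then show ?thesis
      using lm_eval_at_least_term[OF assms(1) j] j k by (auto simp: luk_algebra_def)
  qed
  moreover have "?s \<in> lm_terms n X"
    using assms(3) by (intro lm_terms.intros at_least_term_in_lm_terms)
  ultimately show ?thesis by blast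
qed

text \<open>
  The meet of the indicators of the single values \<open>c x\<close>, built up variable by variable.
\<close>

lemma tuple_indicator:
  assumes "n > 0" "finite Y" "Y \<subseteq> X" "c \<in> Y \<rightarrow> luk_set n"
  shows "\<exists>s \<in> lm_terms n X. \<forall>a \<in> X \<rightarrow> luk_set n.
    lm_eval (luk_algebra n) a s = (if \<forall>x \<in> Y. a x = c x then 1 else 0)"
  using assms(2-)
proof induction
  case empty
  show ?case by (rule bexI[of _ One]) (auto simp: luk_algebra_def intro: lm_terms.intros)
next
  case (insert y Y)
  then obtain s where s: "s \<in> lm_terms n X"
    "\<forall>a \<in> X \<rightarrow> luk_set n.
      lm_eval (luk_algebra n) a s = (if \<forall>x \<in> Y. a x = c x then 1 else 0)"
    by auto
  have "c y \<in> luk_set n" "Var y \<in> lm_terms n X"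
    using insert.prems by (auto intro: lm_terms.intros)
  from value_indicator[OF assms(1) this] obtain s' where s': "s' \<in> lm_terms n X"
    "\<forall>a \<in> X \<rightarrow> luk_set n. lm_eval (luk_algebra n) a s' = (if a y = c y then 1 else 0)"
    by auto
  show ?case
  proof (rule bexI[of _ "Meet s' s"])
    show "Meet s' s \<in> lm_terms n X" using s s' by (intro lm_terms.intros)
    show "\<forall>a \<in> X \<rightarrow> luk_set n. lm_eval (luk_algebra n) a (Meet s' s) =
        (if \<forall>x \<in> insert y Y. a x = c x then 1 else 0)"
    proof
      fix a assume a: "a \<in> X \<rightarrow> luk_set n"
      show "lm_eval (luk_algebra n) a (Meet s' s) =
          (if \<forall>x \<in> insert y Y. a x = c x then 1 else 0)"
        using s(2)[rule_format, OF a] s'(2)[rule_format, OF a] by (auto simp: luk_algebra_def)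
    qed
  qed
qed

lemma finite_luk_tuples: "finite (luk_tuples n r)"
  by (auto simp: luk_tuples_def luk_set_def intro: finite_PiE)

lemma luk_tuples_eq_iff:
  assumes "a \<in> luk_tuples n r" "b \<in> luk_tuples n r"
  shows "a = b \<longleftrightarrow> (\<forall>i \<in> {1..r}. a i = b i)"
  using assms by (metis PiE_ext luk_tuples_def)

text \<open>
  A function that agrees at every single tuple with some term function is itself a term function.
  The tuples are added one at a time: off the set \<open>B\<close> of the tuples treated so far the term
  has the value \<open>0\<close>, the neutral element of the join, so the next tuple does not disturb them.
\<close>

lemma glue_local_terms:
  assumes n: "n > 0"
    and pointwise: "\<And>b. b \<in> luk_tuples n r \<Longrightarrow>
      \<exists>t \<in> lm_terms n {1..r}. lm_eval (luk_algebra n) b t = f b"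
  shows "\<exists>t \<in> lm_terms n {1..r}. \<forall>a \<in> luk_tuples n r. lm_eval (luk_algebra n) a t = f a"
proof -
  have bounds: "0 \<le> lm_eval (luk_algebra n) a t \<and> lm_eval (luk_algebra n) a t \<le> 1"
    if "a \<in> luk_tuples n r" "t \<in> lm_terms n {1..r}" for a t
  proof -
    have "lm_eval (luk_algebra n) a t \<in> luk_set n"
      using lm_eval_in_carrier[OF luk_algebra_closed[OF n] _ that(2), of a] that(1)
      by (auto simp: luk_algebra_def luk_tuples_def)
    then show ?thesis using n by (auto simp: luk_set_def)
  qed
  have "\<exists>t \<in> lm_terms n {1..r}. \<forall>a \<in> luk_tuples n r.
      lm_eval (luk_algebra n) a t = (if a \<in> B then f a else 0)"
    if "finite B" "B \<subseteq> luk_tuples n r" for B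
    using that
  proof induction
    case empty
    show ?case by (rule bexI[of _ Zero]) (auto simp: luk_algebra_def intro: lm_terms.intros)
  next
    case (insert b B)
    then have b: "b \<in> luk_tuples n r" by auto
    from insert obtain t where t: "t \<in> lm_terms n {1..r}"
      "\<forall>a \<in> luk_tuples n r. lm_eval (luk_algebra n) a t = (if a \<in> B then f a else 0)"
      by auto
    from pointwise[OF b] obtain u where u: "u \<in> lm_terms n {1..r}"
      "lm_eval (luk_algebra n) b u = f b"
      by auto
    have "b \<in> {1..r} \<rightarrow> luk_set n" using b by (auto simp: luk_tuples_def)
    from tuple_indicator[OF n _ subset_refl this] obtain s where s: "s \<in> lm_terms n {1..r}"
      "\<forall>a \<in> {1..r} \<rightarrow> luk_set n. lm_eval (luk_algebra n) a s =
        (if \<forall>i \<in> {1..r}. a i = b i then 1 else 0)"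
      by auto
    show ?case
    proof (rule bexI[of _ "Join (Meet s u) t"])
      show "Join (Meet s u) t \<in> lm_terms n {1..r}"
        using s u t by (intro lm_terms.intros)
      show "\<forall>a \<in> luk_tuples n r. lm_eval (luk_algebra n) a (Join (Meet s u) t) =
          (if a \<in> insert b B then f a else 0)"
      proof
        fix a assume a: "a \<in> luk_tuples n r"
        then have "a \<in> {1..r} \<rightarrow> luk_set n" by (auto simp: luk_tuples_def)
        then have "lm_eval (luk_algebra n) a s = (if a = b then 1 else 0)"
          using s(2) luk_tuples_eq_iff[OF a b] by auto
        then show "lm_eval (luk_algebra n) a (Join (Meet s u) t) =
            (if a \<in> insert b B then f a else 0)"
          using t(2)[rule_format, OF a] u(2) bounds[OF a u(1)] bounds[OF a t(1)] insert.hyps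
          by (cases "a = b") (auto simp: luk_algebra_def split: if_splits)
      qed
    qed
  qed
  from this[OF finite_luk_tuples subset_refl] show ?thesis by auto
qed

theorem theorem2p4:
  fixes n r :: nat and f :: "(nat \<Rightarrow> real) \<Rightarrow> real"
  assumes "n \<ge> 2" and "r \<ge> 1"
    and "f \<in> luk_tuples n r \<rightarrow> luk_set n"
  shows "moisil_representable n r f \<longleftrightarrow>
    (\<forall>a \<in> luk_tuples n r. f a \<in> {0, 1} \<union> a ` {1..r} \<union> (\<lambda>i. 1 - a i) ` {1..r})"
proof -
  from assms(1) have n: "n > 0" by simp
  show ?thesis
    unfolding moisil_representable_iff_term_function[OF n]
  proof
    assume "\<exists>t \<in> lm_terms n {1..r}. \<forall>a \<in> luk_tuples n r. lm_eval (luk_algebra n) a t = f a"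
    then show "\<forall>a \<in> luk_tuples n r. f a \<in> {0, 1} \<union> a ` {1..r} \<union> (\<lambda>i. 1 - a i) ` {1..r}"
      using term_function_values by metis
  next
    assume vals:
      "\<forall>a \<in> luk_tuples n r. f a \<in> {0, 1} \<union> a ` {1..r} \<union> (\<lambda>i. 1 - a i) ` {1..r}"
    show "\<exists>t \<in> lm_terms n {1..r}. \<forall>a \<in> luk_tuples n r. lm_eval (luk_algebra n) a t = f a"
    proof (rule glue_local_terms[OF n])
      fix b assume "b \<in> luk_tuples n r"
      with vals consider "f b = 0" | "f b = 1" | i where "i \<in> {1..r}" "f b = b i"
        | i where "i \<in> {1..r}" "f b = 1 - b i"
        by blast
      then show "\<exists>t \<in> lm_terms n {1..r}. lm_eval (luk_algebra n) b t = f b"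
      proof cases
        case 1
        then show ?thesis
          by (intro bexI[of _ Zero]) (auto simp: luk_algebra_def intro: lm_terms.intros)
      next
        case 2
        then show ?thesis
          by (intro bexI[of _ One]) (auto simp: luk_algebra_def intro: lm_terms.intros)
      next
        case (3 i)
        then show ?thesis
          by (intro bexI[of _ "Var i"]) (auto intro: lm_terms.intros)
      next
        case (4 i)
        then show ?thesis
          by (intro bexI[of _ "Neg (Var i)"])
            (auto simp: luk_algebra_def intro!: lm_terms.intros)
      qed
    qed
  qed
qed

end
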